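(* Let $n\in\mathbb{R}_{>0}$, $\mathbf p\in\mathbb{R}^2$, and let $\Lambda$ be a superlattice of $\mathbb{Z}^2$ such that $(0,1)$ and $(1,0)$ are primitive vectors of $\Lambda$. Define $m:=\frac{1}{\det\Lambda}\max\{n,2\}$. Then for every real number $k\ge2$, the number of vertices of $\mathrm{conv}(H_n\cap(\mathbf p+\Lambda))$ is at most \[ \left(\frac{2^8\pi^2(k-1)^2}{k}\right)^{1/3} m^{1/3}(\log_k m+2). \] In particular it is in $O(m^{1/3}\log m)$.
   Context: $H_n:=\{(x,y)\in\mathbb{R}_{\ge0}^2: xy\ge n\}$. $\det\Lambda$ is the area of a fundamental parallelogram of $\Lambda$. A lattice vector is primitive if it is nonzero and not an integer multiple $k\mathbf w$, $k\ge 2$, of a lattice vector $\mathbf w$. *)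

theory Defs
  imports "HOL-Analysis.Analysis"
begin

definition lattice_basis :: "real^2 \<Rightarrow> real^2 \<Rightarrow> (real^2) set \<Rightarrow> bool" where
  "lattice_basis u v L \<longleftrightarrow> u \<noteq> v \<and> independent {u, v} \<and>
     L = {of_int a *\<^sub>R u + of_int b *\<^sub>R v | a b. True}"

definition plane_lattice :: "(real^2) set \<Rightarrow> bool" where
  "plane_lattice L \<longleftrightarrow> (\<exists>u v. lattice_basis u v L)"

definition integer_lattice :: "(real^2) set" where
  "integer_lattice = {x. \<forall>i. x $ i \<in> \<int>}"

definition parallelogram :: "real^2 \<Rightarrow> real^2 \<Rightarrow> (real^2) set" where
  "parallelogram u v = {s *\<^sub>R u + t *\<^sub>R v | s t. s \<in> {0..1} \<and> t \<in> {0..1}}"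

text \<open>The area does not depend on the chosen basis (see \<open>lattice_det_eq\<close> below), so the
  definite description is well defined for every lattice.\<close>

definition lattice_det :: "(real^2) set \<Rightarrow> real" where
  "lattice_det L = (THE d. \<exists>u v. lattice_basis u v L \<and> d = measure lebesgue (parallelogram u v))"

definition primitive_vector :: "(real^2) set \<Rightarrow> real^2 \<Rightarrow> bool" where
  "primitive_vector L v \<longleftrightarrow> v \<in> L \<and> v \<noteq> 0 \<and>
     \<not> (\<exists>k::int. k \<ge> 2 \<and> (\<exists>w\<in>L. v = of_int k *\<^sub>R w))"

definition hyperbola_region :: "real \<Rightarrow> (real^2) set" where
  "hyperbola_region n = {x. x $ 1 \<ge> 0 \<and> x $ 2 \<ge> 0 \<and> x $ 1 * x $ 2 \<ge> n}"

definition hull_vertices :: "real \<Rightarrow> real^2 \<Rightarrow> (real^2) set \<Rightarrow> (real^2) set" where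
  "hull_vertices n p L =
     {x. x extreme_point_of (convex hull (hyperbola_region n \<inter> (\<lambda>v. p + v) ` L))}"

definition admissible_superlattice :: "(real^2) set \<Rightarrow> bool" where
  "admissible_superlattice L \<longleftrightarrow> plane_lattice L \<and> integer_lattice \<subseteq> L \<and>
     primitive_vector L (vector [0, 1]) \<and> primitive_vector L (vector [1, 0])"

definition size_parameter :: "real \<Rightarrow> (real^2) set \<Rightarrow> real" where
  "size_parameter n L = (1 / lattice_det L) * max n 2"

lemma measure_parallelogram:
  "measure lebesgue (parallelogram u v) = \<bar>u $ 1 * v $ 2 - u $ 2 * v $ 1\<bar>"
proof -
  define f :: "real^2 \<Rightarrow> real^2" where "f = (\<lambda>x. x $ 1 *\<^sub>R u + x $ 2 *\<^sub>R v)"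
  have lin: "linear f"
    unfolding f_def by (rule linearI) (simp_all add: algebra_simps)
  have "s *\<^sub>R u + t *\<^sub>R v \<in> f ` cbox 0 1" if "s \<in> {0..1}" "t \<in> {0..1}" for s t
    by (rule image_eqI[of _ _ "vector [s, t]"])
      (use that in \<open>simp_all add: f_def mem_box_cart forall_2\<close>)
  moreover have "f x \<in> parallelogram u v" if "x \<in> cbox 0 1" for x
    unfolding parallelogram_def f_def mem_Collect_eq
    by (rule exI[of _ "x $ 1"], rule exI[of _ "x $ 2"])
      (use that in \<open>simp add: mem_box_cart forall_2\<close>)
  ultimately have im: "parallelogram u v = f ` cbox 0 1"
    unfolding parallelogram_def by blast
  have "det (matrix f) = u $ 1 * v $ 2 - u $ 2 * v $ 1"
    by (simp add: det_2 matrix_def f_def axis_def algebra_simps)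
  then show ?thesis
    unfolding im using measure_linear_image[OF lin, of "cbox 0 1"]
    by (simp add: content_cbox_cart interval_ne_empty_cart)
qed

lemma lattice_basis_area_le:
  assumes B: "lattice_basis u v L" and B': "lattice_basis u' v' L"
  shows "measure lebesgue (parallelogram u v) \<le> measure lebesgue (parallelogram u' v')"
proof -
  have mem: "x \<in> L" if "x = u' \<or> x = v'" for x
  proof -
    have "u' = of_int 1 *\<^sub>R u' + of_int 0 *\<^sub>R v'" "v' = of_int 0 *\<^sub>R u' + of_int 1 *\<^sub>R v'"
      by simp_all
    then show ?thesis
      using B' that unfolding lattice_basis_def by blast
  qed
  obtain a b c d :: int
    where u': "u' = of_int a *\<^sub>R u + of_int b *\<^sub>R v"
      and v': "v' = of_int c *\<^sub>R u + of_int d *\<^sub>R v"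
    using mem[of u'] mem[of v'] B unfolding lattice_basis_def by blast
  have "u' $ 1 * v' $ 2 - u' $ 2 * v' $ 1 =
      of_int (a * d - b * c) * (u $ 1 * v $ 2 - u $ 2 * v $ 1)"
    by (simp add: u' v' algebra_simps)
  then have eq: "measure lebesgue (parallelogram u' v') =
      of_int \<bar>a * d - b * c\<bar> * measure lebesgue (parallelogram u v)"
    by (simp add: measure_parallelogram abs_mult)
  have "a * d - b * c \<noteq> 0"
  proof
    assume z: "a * d - b * c = 0"
    have ind: "independent {u', v'}" and ne: "u' \<noteq> v'"
      using B' by (auto simp: lattice_basis_def)
    have rel: "s = 0 \<and> t = 0" if "s *\<^sub>R u' + t *\<^sub>R v' = 0" for s t
    proof -
      have "(if w = u' then s else t) = 0" if "w \<in> {u', v'}" for w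
        using independentD[OF ind, of "{u', v'}" "\<lambda>x. if x = u' then s else t" w]
          that \<open>s *\<^sub>R u' + t *\<^sub>R v' = 0\<close> ne by auto
      from this[of u'] this[of v'] ne show ?thesis
        by simp
    qed
    have zr: "real_of_int a * of_int d = of_int b * of_int c"
      using z by (metis eq_iff_diff_eq_0 of_int_mult)
    have "of_int d *\<^sub>R u' + (- of_int b) *\<^sub>R v' = (of_int a * of_int d - of_int b * of_int c) *\<^sub>R u"
      by (simp add: u' v' algebra_simps)
    then have "d = 0" "b = 0"
      using rel[of "of_int d" "- of_int b"] zr by auto
    moreover have "of_int c *\<^sub>R u' + (- of_int a) *\<^sub>R v' = (of_int b * of_int c - of_int a * of_int d) *\<^sub>R v"
      by (simp add: u' v' algebra_simps)
    then have "a = 0"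
      using rel[of "of_int c" "- of_int a"] zr by auto
    ultimately have "u' = 0"
      by (simp add: u')
    then show False
      using ind dependent_zero by blast
  qed
  then have "1 \<le> real_of_int \<bar>a * d - b * c\<bar>"
    by linarith
  then show ?thesis
    unfolding eq using mult_right_mono[of 1 "real_of_int \<bar>a * d - b * c\<bar>"
        "measure lebesgue (parallelogram u v)"] by simp
qed

lemma lattice_det_eq:
  assumes "lattice_basis u v L"
  shows "lattice_det L = measure lebesgue (parallelogram u v)"
  unfolding lattice_det_def
  using assms by (intro the_equality) (auto intro: antisym lattice_basis_area_le)

end

theory Submission
  imports Defs
begin

text \<open>Any two consecutive edges of the hull span a parallelogram of area at least
  \<open>d = lattice_det L\<close>. By AM-GM a convex chain of lattice points in an \<open>A \<times> B\<close> box therefore has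
  at most \<open>2 + (4 A B / d)\<^sup>1\<^sup>/\<^sup>3\<close> vertices. Minimality keeps every vertex within distance \<open>1\<close> of the
  hyperbola in both coordinate directions. So, with \<open>M = max n 2\<close>, the vertices with
  \<open>s < x \<le> k s\<close> for \<open>s \<le> M\<close> lie in a box of area at most \<open>3 M (k - 1)\<^sup>2 / k\<close>. About
  \<open>log k (M / d)\<close> such slabs cover \<open>d < x \<le> M\<close>, and at most one vertex has \<open>x \<le> d\<close>. As every
  vertex has \<open>x \<le> M\<close> or \<open>y \<le> M\<close>, exchanging the axes takes care of the remaining
  ones.\<close>

section \<open>Convex chains in a box\<close>

text \<open>AM-GM for \<open>s\<close>, \<open>t\<close> and \<open>1 / (s * t)\<close>, whose
  product is 1; passing to the geometric mean of \<open>s\<close> and \<open>t\<close> leaves a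
  single variable.\<close>

lemma three_le_sum_add_inverse_mult:
  fixes s t :: real
  assumes "0 < s" "0 < t"
  shows "3 \<le> s + t + 1 / (s * t)"
proof -
  define p where "p = sqrt (s * t)"
  have p: "0 < p" "p\<^sup>2 = s * t"
    using assms by (simp_all add: p_def)
  have "2 * p \<le> s + t"
    using arith_geo_mean_sqrt[of s t] assms by (simp add: p_def)
  moreover have "3 \<le> 2 * p + 1 / p\<^sup>2"
  proof -
    \<comment> \<open>Factored form of \<open>2 * p ^ 3 - 3 * p\<^sup>2 + 1\<close>, which has a
      double zero at \<open>p = 1\<close>.\<close>
    have "0 \<le> (p - 1)\<^sup>2 * (2 * p + 1)"
      using p by simp
    then have "3 * p\<^sup>2 \<le> 2 * p * p\<^sup>2 + 1"
      by (simp add: algebra_simps power2_eq_square)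
    also have "\<dots> = (2 * p + 1 / p\<^sup>2) * p\<^sup>2"
      using p(1) by (simp add: distrib_right)
    finally show ?thesis
      using p(1) by simp
  qed
  ultimately show ?thesis
    by (simp add: p(2))
qed

text \<open>Here \<open>a i\<close> and \<open>- b i\<close> are the coordinates of the edges of a convex chain. In the normalised
  coordinates \<open>\<alpha> = a / A\<close>, \<open>\<beta> = b / B\<close> with \<open>\<sigma> = \<alpha> + \<beta>\<close>, the ratio \<open>\<alpha> / \<sigma>\<close> climbs from
  \<open>0\<close> to \<open>1\<close> in steps of at least \<open>d / (A B \<sigma> \<sigma>')\<close>, whereas the \<open>\<sigma>\<close> add up to at most
  \<open>2\<close>.\<close>

lemma convex_chain_edge_bound:
  fixes a b :: "nat \<Rightarrow> real"
  assumes pos: "\<And>i. i \<le> q \<Longrightarrow> 0 < a i" "\<And>i. i \<le> q \<Longrightarrow> 0 < b i"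
    and sums: "(\<Sum>i\<le>q. a i) \<le> A" "(\<Sum>i\<le>q. b i) \<le> B"
    and det: "\<And>i. i < q \<Longrightarrow> d \<le> b i * a (Suc i) - b (Suc i) * a i"
    and d: "0 < d"
  shows "real q ^ 3 \<le> 4 * A * B / d"
proof (cases "q = 0")
  case True
  have "0 < A" "0 < B"
    using sums sum_pos[of "{..q}" a] sum_pos[of "{..q}" b] pos by force+
  then show ?thesis
    using d True by simp
next
  case False
  then have q: "0 < real q"
    by simp
  have AB: "0 < A" "0 < B"
    using sums sum_pos[of "{..q}" a] sum_pos[of "{..q}" b] pos by force+
  define \<sigma> where "\<sigma> i = a i / A + b i / B" for i
  define \<tau> where "\<tau> i = (a i / A) / \<sigma> i" for i
  define K where "K = A * B / d"
  have K: "0 < K"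
    using AB d by (simp add: K_def)
  have \<sigma>pos: "0 < \<sigma> i" if "i \<le> q" for i
    using pos[OF that] AB by (simp add: \<sigma>_def add_pos_pos)
  have "(\<Sum>i\<le>q. \<sigma> i) = (\<Sum>i\<le>q. a i) / A + (\<Sum>i\<le>q. b i) / B"
    by (simp add: \<sigma>_def sum.distrib sum_divide_distrib)
  also have "\<dots> \<le> 1 + 1"
    using sums AB by (intro add_mono) simp_all
  finally have \<sigma>sum: "(\<Sum>i\<le>q. \<sigma> i) \<le> 2"
    by simp
  have \<sigma>sum1: "(\<Sum>i<q. \<sigma> i) \<le> 2"
    using \<sigma>sum \<sigma>pos[of q] by (simp flip: lessThan_Suc_atMost)
  have "(\<Sum>i\<le>q. \<sigma> i) = \<sigma> 0 + (\<Sum>i<q. \<sigma> (Suc i))"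
    by (simp add: sum.lessThan_Suc_shift del: sum.lessThan_Suc flip: lessThan_Suc_atMost)
  then have \<sigma>sum2: "(\<Sum>i<q. \<sigma> (Suc i)) \<le> 2"
    using \<sigma>sum \<sigma>pos[of 0] by simp
  have step: "1 / (\<sigma> i * \<sigma> (Suc i)) \<le> K * (\<tau> (Suc i) - \<tau> i)" if "i < q" for i
  proof -
    have s: "0 < \<sigma> i" "0 < \<sigma> (Suc i)"
      using that by (simp_all add: \<sigma>pos)
    have "\<tau> (Suc i) - \<tau> i =
        (a (Suc i) / A * \<sigma> i - a i / A * \<sigma> (Suc i)) / (\<sigma> i * \<sigma> (Suc i))"
      unfolding \<tau>_def using s by (subst diff_frac_eq) (simp_all add: mult.commute)
    \<comment> \<open>The terms in \<open>a i * a (Suc i)\<close> cancel and leave the determinant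
      of two consecutive edges.\<close>
    also have "a (Suc i) / A * \<sigma> i - a i / A * \<sigma> (Suc i) =
        (b i * a (Suc i) - b (Suc i) * a i) / (A * B)"
      using AB by (simp add: \<sigma>_def field_simps)
    finally have "K * (\<tau> (Suc i) - \<tau> i) =
        ((b i * a (Suc i) - b (Suc i) * a i) / d) / (\<sigma> i * \<sigma> (Suc i))"
      using AB by (simp add: K_def)
    moreover have "1 \<le> (b i * a (Suc i) - b (Suc i) * a i) / d"
      using det[OF that] d by simp
    ultimately show ?thesis
      using s by (simp only: divide_right_mono mult_nonneg_nonneg less_imp_le)
  qed
  have "(\<Sum>i<q. 1 / (\<sigma> i * \<sigma> (Suc i))) \<le> (\<Sum>i<q. K * (\<tau> (Suc i) - \<tau> i))"
    using step by (intro sum_mono) auto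
  also have "\<dots> = K * (\<tau> q - \<tau> 0)"
    by (simp add: sum_lessThan_telescope flip: sum_distrib_left)
  also have "\<dots> \<le> K * 1"
  proof (rule mult_left_mono)
    have "a q / A \<le> \<sigma> q"
      using pos[of q] AB by (simp add: \<sigma>_def)
    then have "\<tau> q \<le> 1"
      using \<sigma>pos[of q] by (simp only: \<tau>_def divide_le_eq_1_pos)
    moreover have "0 \<le> \<tau> 0"
      using \<sigma>pos[of 0] pos(1)[of 0] AB by (simp add: \<tau>_def)
    ultimately show "\<tau> q - \<tau> 0 \<le> 1"
      by simp
  qed (use K in simp)
  finally have inv: "(\<Sum>i<q. 1 / (\<sigma> i * \<sigma> (Suc i))) \<le> K"
    by simp
  \<comment> \<open>Each of the two sums of \<open>q\<close> values of \<open>\<sigma>\<close> is at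
    most 2, so \<open>2 / q\<close> bounds their mean. With this scale the linear terms of AM-GM add
    up to at most \<open>2 * q\<close>, which leaves \<open>q\<close> for the reciprocal
    terms.\<close>
  define \<mu> where "\<mu> = 2 / real q"
  have \<mu>: "0 < \<mu>"
    using q by (simp add: \<mu>_def)
  have "3 * real q = (\<Sum>i<q. 3)"
    by simp
  also have "\<dots> \<le> (\<Sum>i<q. (\<sigma> i + \<sigma> (Suc i)) / \<mu> + \<mu>\<^sup>2 * (1 / (\<sigma> i * \<sigma> (Suc i))))"
  proof (rule sum_mono)
    fix i assume "i \<in> {..<q}"
    then have "0 < \<sigma> i / \<mu>" "0 < \<sigma> (Suc i) / \<mu>"
      using \<mu> by (simp_all add: \<sigma>pos)
    from three_le_sum_add_inverse_mult[OF this]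
    show "3 \<le> (\<sigma> i + \<sigma> (Suc i)) / \<mu> + \<mu>\<^sup>2 * (1 / (\<sigma> i * \<sigma> (Suc i)))"
      by (simp add: add_divide_distrib power2_eq_square)
  qed
  also have "\<dots> = ((\<Sum>i<q. \<sigma> i) + (\<Sum>i<q. \<sigma> (Suc i))) / \<mu> +
      \<mu>\<^sup>2 * (\<Sum>i<q. 1 / (\<sigma> i * \<sigma> (Suc i)))"
    by (simp only: sum.distrib sum_distrib_left flip: sum_divide_distrib)
  also have "\<dots> \<le> 4 / \<mu> + \<mu>\<^sup>2 * K"
    using \<sigma>sum1 \<sigma>sum2 inv \<mu> by (intro add_mono divide_right_mono mult_left_mono) auto
  also have "\<dots> = 2 * real q + 4 * K / (real q)\<^sup>2"
    by (simp add: \<mu>_def power_divide)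
  finally have "real q \<le> 4 * K / (real q)\<^sup>2"
    by simp
  then have "real q * (real q)\<^sup>2 \<le> 4 * K"
    using q by (simp add: pos_le_divide_eq)
  then show ?thesis
    by (simp add: K_def power3_eq_cube power2_eq_square mult.assoc)
qed

text \<open>Once the points are sorted by \<open>X\<close>, their consecutive differences are the
  edges of a chain, and the edge bound applies.\<close>

lemma convex_chain_card_bound:
  fixes X Y :: "'a \<Rightarrow> real"
  assumes "finite V"
    and inj: "inj_on X V"
    and anti: "\<And>u v. u \<in> V \<Longrightarrow> v \<in> V \<Longrightarrow> X u < X v \<Longrightarrow> Y v < Y u"
    and det: "\<And>u v w. u \<in> V \<Longrightarrow> v \<in> V \<Longrightarrow> w \<in> V \<Longrightarrow> X u < X v \<Longrightarrow> X v < X w \<Longrightarrow>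
      d \<le> (Y u - Y v) * (X w - X v) - (Y v - Y w) * (X v - X u)"
    and width: "\<And>u v. u \<in> V \<Longrightarrow> v \<in> V \<Longrightarrow> X v - X u \<le> A"
    and height: "\<And>u v. u \<in> V \<Longrightarrow> v \<in> V \<Longrightarrow> Y u - Y v \<le> B"
    and d: "0 < d"
  shows "real (card V) \<le> 2 + (4 * A * B / d) powr (1 / 3)"
proof (cases "card V \<le> 2")
  case True
  then show ?thesis
    using powr_ge_zero[of "4 * A * B / d" "1 / 3"] by linarith
next
  case False
  define xs where "xs = sorted_list_of_set (X ` V)"
  \<comment> \<open>There are \<open>q + 2\<close> vertices, \<open>q + 1\<close> edges and
    \<open>q\<close> pairs of consecutive edges; hence the additive 2 in the bound.\<close>
  define q where "q = card V - 2"
  have len: "length xs = q + 2"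
    using False by (simp add: xs_def q_def card_image[OF inj])
  have set: "set xs = X ` V" and sorted: "sorted_wrt (<) xs"
    using \<open>finite V\<close> by (simp_all add: xs_def strict_sorted_list_of_set)
  define f where "f i = inv_into V X (xs ! i)" for i
  have f: "f i \<in> V" "X (f i) = xs ! i" if "i < q + 2" for i
  proof -
    have "xs ! i \<in> X ` V"
      using that set len nth_mem[of i xs] by simp
    then show "f i \<in> V" "X (f i) = xs ! i"
      by (simp_all add: f_def inv_into_into f_inv_into_f)
  qed
  have less: "X (f i) < X (f (Suc i))" if "i < q + 1" for i
    using that f(2) sorted_wrt_nth_less[OF sorted, of i "Suc i"] len by simp
  have "real q ^ 3 \<le> 4 * A * B / d"
  proof (rule convex_chain_edge_bound)
    show "0 < X (f (Suc i)) - X (f i)" if "i \<le> q" for i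
      using less[of i] that by simp
    show "0 < Y (f i) - Y (f (Suc i))" if "i \<le> q" for i
      using anti[OF f(1) f(1) less] that by simp
    have "(\<Sum>i\<le>q. X (f (Suc i)) - X (f i)) = X (f (Suc q)) - X (f 0)"
      using sum_lessThan_telescope[of "\<lambda>i. X (f i)" "Suc q"] by (simp add: lessThan_Suc_atMost)
    then show "(\<Sum>i\<le>q. X (f (Suc i)) - X (f i)) \<le> A"
      using width f(1) by simp
    have "(\<Sum>i\<le>q. Y (f i) - Y (f (Suc i))) = Y (f 0) - Y (f (Suc q))"
      using sum_lessThan_telescope'[of "\<lambda>i. Y (f i)" "Suc q"] by (simp add: lessThan_Suc_atMost)
    then show "(\<Sum>i\<le>q. Y (f i) - Y (f (Suc i))) \<le> B"
      using height f(1) by simp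
    show "d \<le> (Y (f i) - Y (f (Suc i))) * (X (f (Suc (Suc i))) - X (f (Suc i))) -
        (Y (f (Suc i)) - Y (f (Suc (Suc i)))) * (X (f (Suc i)) - X (f i))" if "i < q" for i
      using that by (intro det f(1) less) simp_all
  qed (rule d)
  then have "(real q ^ 3) powr (1 / 3) \<le> (4 * A * B / d) powr (1 / 3)"
    by (intro powr_mono2) simp_all
  moreover have "(real q ^ 3) powr (1 / 3) = real q"
    using False by (simp add: q_def powr_powr flip: powr_numeral)
  ultimately show ?thesis
    using False by (simp add: q_def)
qed

section \<open>Slab-by-slab counting along the hyperbola\<close>

text \<open>For \<open>k \<ge> 2\<close> the weight \<open>(k - 1)\<^sup>2 / k\<close> is at least
  \<open>1 / 2\<close>, its value at \<open>k = 2\<close>. This allows additive constants to be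
  absorbed into the cube root term.\<close>

lemma one_le_weight_mult:
  fixes k m :: real
  assumes "2 \<le> k" "2 \<le> m"
  shows "1 \<le> (k - 1)\<^sup>2 / k * m"
proof -
  have "0 \<le> (2 * k - 1) * (k - 2)"
    using assms by simp
  then have "1 / 2 \<le> (k - 1)\<^sup>2 / k"
    using assms by (simp add: field_simps power2_eq_square)
  then show ?thesis
    using mult_mono[of "1 / 2" "(k - 1)\<^sup>2 / k" 2 m] assms by simp
qed

text \<open>The coordinates are abstract functions so that the two axes can be interchanged.\<close>

locale hyperbola_chain =
  fixes V :: "'a set" and X Y :: "'a \<Rightarrow> real" and n d :: real
  assumes finite: "finite V"
    and n_pos: "0 < n"
    and d_pos: "0 < d"
    and d_le_1: "d \<le> 1"
    and X_pos: "v \<in> V \<Longrightarrow> 0 < X v"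
    and Y_pos: "v \<in> V \<Longrightarrow> 0 < Y v"
    and above: "v \<in> V \<Longrightarrow> n \<le> X v * Y v"
    and Y_upper: "v \<in> V \<Longrightarrow> Y v < n / X v + 1"
    and X_upper: "v \<in> V \<Longrightarrow> X v < n / Y v + 1"
    and X_gap: "u \<in> V \<Longrightarrow> v \<in> V \<Longrightarrow> X u < X v \<Longrightarrow> d \<le> X v - X u"
    and Y_gap: "u \<in> V \<Longrightarrow> v \<in> V \<Longrightarrow> Y u < Y v \<Longrightarrow> d \<le> Y v - Y u"
    and strict_anti: "u \<in> V \<Longrightarrow> v \<in> V \<Longrightarrow> u \<noteq> v \<Longrightarrow> X u \<le> X v \<Longrightarrow> Y v < Y u"
    and det_ge: "u \<in> V \<Longrightarrow> v \<in> V \<Longrightarrow> w \<in> V \<Longrightarrow> X u < X v \<Longrightarrow> X v < X w \<Longrightarrow>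
      d \<le> (Y u - Y v) * (X w - X v) - (Y v - Y w) * (X v - X u)"
begin

lemma inj_on_X: "inj_on X V"
  by (rule inj_onI) (metis order.refl less_asym strict_anti)

text \<open>Reflection in the diagonal reverses the order along the chain, so the determinant
  condition comes from the reversed triple.\<close>

lemma swap: "hyperbola_chain V Y X n d"
proof
  fix u v assume *: "u \<in> V" "v \<in> V" "u \<noteq> v" "Y u \<le> Y v"
  then show "X v < X u"
    using strict_anti[of u v] by linarith
next
  fix u v w assume *: "u \<in> V" "v \<in> V" "w \<in> V" "Y u < Y v" "Y v < Y w"
  then have "X v < X u" "X w < X v"
    using strict_anti[of u v] strict_anti[of v w] by fastforce+
  then show "d \<le> (X u - X v) * (Y w - Y v) - (X v - X w) * (Y v - Y u)"
    using det_ge[of w v u] * by (simp add: algebra_simps)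
qed (use finite n_pos d_pos d_le_1 X_pos Y_pos above X_upper Y_upper X_gap Y_gap
     in \<open>simp_all add: mult.commute\<close>)

lemma card_slab_le:
  assumes k: "2 \<le> k" and s: "0 < s" "s \<le> max n 2"
  shows "real (card {v \<in> V. s < X v \<and> X v \<le> k * s}) \<le>
    2 + (12 * ((k - 1)\<^sup>2 / k * (max n 2 / d))) powr (1 / 3)"
proof -
  define M where "M = max n 2"
  define A where "A = (k - 1) * s"
  \<comment> \<open>Over the slab the hyperbola drops from \<open>n / s\<close> to
    \<open>n / (k * s)\<close>; the 1 is the thickness of the layer above it that holds the
    vertices.\<close>
  define B where "B = n / s + 1 - n / (k * s)"
  have "real (card {v \<in> V. s < X v \<and> X v \<le> k * s}) \<le> 2 + (4 * A * B / d) powr (1 / 3)"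
  proof (rule convex_chain_card_bound[where X = X and Y = Y])
    show "inj_on X {v \<in> V. s < X v \<and> X v \<le> k * s}"
      by (rule inj_on_subset[OF inj_on_X]) auto
    show "Y v < Y u" if "u \<in> {v \<in> V. s < X v \<and> X v \<le> k * s}"
      "v \<in> {v \<in> V. s < X v \<and> X v \<le> k * s}" "X u < X v" for u v
      using that by (intro strict_anti) auto
    show "X v - X u \<le> A" if "u \<in> {v \<in> V. s < X v \<and> X v \<le> k * s}"
      "v \<in> {v \<in> V. s < X v \<and> X v \<le> k * s}" for u v
      using that by (auto simp: A_def algebra_simps)
    show "Y u - Y v \<le> B" if "u \<in> {v \<in> V. s < X v \<and> X v \<le> k * s}"
      "v \<in> {v \<in> V. s < X v \<and> X v \<le> k * s}" for u v
    proof -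
      have "n / X u \<le> n / s"
        using that n_pos s by (auto intro: divide_left_mono)
      then have "Y u \<le> n / s + 1"
        using Y_upper[of u] that by simp
      moreover have "n / (k * s) \<le> n / X v"
        using that n_pos s k by (auto intro!: divide_left_mono mult_pos_pos)
      moreover have "n / X v \<le> Y v"
        using above[of v] X_pos[of v] that by (simp add: pos_divide_le_eq mult.commute)
      ultimately show ?thesis
        by (simp add: B_def)
    qed
  qed (use finite d_pos det_ge in auto)
  also have "\<dots> \<le> 2 + (12 * ((k - 1)\<^sup>2 / k * (M / d))) powr (1 / 3)"
  proof (intro add_left_mono powr_mono2)
    have AB: "A * B = (k - 1)\<^sup>2 / k * n + (k - 1) * s"
      using k s by (simp add: A_def B_def field_simps power2_eq_square)
    have "n / (k * s) \<le> n / s"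
      using k s n_pos by (intro divide_left_mono) auto
    then have "0 \<le> A * B"
      using k s by (simp add: A_def B_def)
    then show "0 \<le> 4 * A * B / d"
      using d_pos by (simp add: mult.assoc)
    \<comment> \<open>Equivalent to \<open>k \<le> 2 * (k - 1)\<close>. With
      \<open>s \<le> M\<close>, the layer contributes at most twice
      \<open>(k - 1)\<^sup>2 / k * M\<close> to the area and the hyperbola at most once that, hence
      the factor 3.\<close>
    have "k - 1 \<le> 2 * ((k - 1)\<^sup>2 / k)"
      using k mult_left_mono[of k "2 * (k - 1)" "k - 1"]
      by (simp add: pos_le_divide_eq power2_eq_square mult_ac)
    then have "(k - 1) * s \<le> 2 * ((k - 1)\<^sup>2 / k) * M"
      using k s by (intro mult_mono) (simp_all add: M_def)
    moreover have "(k - 1)\<^sup>2 / k * n \<le> (k - 1)\<^sup>2 / k * M"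
      using k by (intro mult_left_mono) (simp_all add: M_def)
    ultimately have "A * B \<le> (k - 1)\<^sup>2 / k * M + 2 * ((k - 1)\<^sup>2 / k) * M"
      unfolding AB by (rule add_mono[rotated])
    then have "A * B \<le> 3 * ((k - 1)\<^sup>2 / k * M)"
      by (simp add: algebra_simps)
    then have "4 * (A * B) / d \<le> 12 * ((k - 1)\<^sup>2 / k * M) / d"
      using d_pos by (intro divide_right_mono) simp_all
    then show "4 * A * B / d \<le> 12 * ((k - 1)\<^sup>2 / k * (M / d))"
      by (simp add: mult.assoc)
  qed simp
  finally show ?thesis
    by (simp add: M_def)
qed

text \<open>As every \<open>X\<close> is positive, two such vertices would differ by less than
  \<open>d\<close>, against \<open>X_gap\<close>.\<close>

lemma card_X_le_d: "card {v \<in> V. X v \<le> d} \<le> 1"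
proof -
  have "u = v" if "u \<in> V" "X u \<le> d" "v \<in> V" "X v \<le> d" for u v
  proof (rule ccontr)
    assume "u \<noteq> v"
    then have "X u < X v \<or> X v < X u"
      using that inj_on_X by (metis inj_onD linorder_neqE)
    then show False
      using X_gap[of u v] X_gap[of v u] X_pos[of u] X_pos[of v] that by linarith
  qed
  then have "\<exists>v. {v \<in> V. X v \<le> d} \<subseteq> {v}"
    by blast
  then show ?thesis
    by (metis card_mono finite.emptyI finite.insertI card_1_singleton_iff One_nat_def)
qed

lemma card_X_le_max:
  assumes k: "2 \<le> k"
  shows "real (card {v \<in> V. X v \<le> max n 2}) \<le>
    1 + (log k (max n 2 / d) + 1) * (5 * ((k - 1)\<^sup>2 / k * (max n 2 / d)) powr (1 / 3))"
proof -
  define M where "M = max n 2"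
  define m where "m = M / d"
  define Q where "Q = ((k - 1)\<^sup>2 / k * m) powr (1 / 3)"
  define J where "J = nat \<lceil>log k m\<rceil>"
  \<comment> \<open>The upper end \<open>M / k ^ j\<close> is written as \<open>k\<close> times the
    lower end, the form needed for \<open>card_slab_le\<close>.\<close>
  define P where "P j = {v \<in> V. M / k ^ Suc j < X v \<and> X v \<le> k * (M / k ^ Suc j)}" for j
  have M: "2 \<le> M"
    by (simp add: M_def)
  have m: "2 \<le> m"
    using M d_pos d_le_1 mult_left_mono[of d 1 2] by (simp add: m_def pos_le_divide_eq)
  have \<kappa>m: "1 \<le> (k - 1)\<^sup>2 / k * m"
    by (rule one_le_weight_mult[OF k m])
  then have Q: "1 \<le> Q"
    by (simp add: Q_def ge_one_powr_ge_zero)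
  \<comment> \<open>Enlarging 12 to 27 gives an exact cube root; then
    \<open>2 + 3 * Q \<le> 5 * Q\<close> because \<open>Q \<ge> 1\<close>.\<close>
  have "(12 * ((k - 1)\<^sup>2 / k * m)) powr (1 / 3) \<le> (3 ^ 3 * ((k - 1)\<^sup>2 / k * m)) powr (1 / 3)"
    using \<kappa>m by (intro powr_mono2) auto
  also have "\<dots> = (3 ^ 3) powr (1 / 3) * Q"
    using \<kappa>m by (simp only: Q_def powr_mult)
  also have "(3 ^ 3 :: real) powr (1 / 3) = 3"
    using powr_powr[of "3::real" 3 "1 / 3"] by simp
  finally have "2 + (12 * ((k - 1)\<^sup>2 / k * m)) powr (1 / 3) \<le> 5 * Q"
    using Q by simp
  moreover have "real (card (P j)) \<le> 2 + (12 * ((k - 1)\<^sup>2 / k * m)) powr (1 / 3)" for j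
    unfolding P_def m_def M_def
  proof (rule card_slab_le[OF k])
    show "max n 2 / k ^ Suc j \<le> max n 2"
      using k M one_le_power[of k "Suc j"] mult_left_mono[of 1 "k ^ Suc j" M]
      unfolding M_def[symmetric] by (simp add: pos_divide_le_eq del: power_Suc)
  qed (use k in simp)
  ultimately have P: "real (card (P j)) \<le> 5 * Q" for j
    using order_trans by blast
  \<comment> \<open>After \<open>J\<close> slabs the lower end has dropped to at most
    \<open>d\<close>, where \<open>card_X_le_d\<close> takes over.\<close>
  have "M / k ^ J \<le> d"
  proof -
    have "log k m \<le> real J"
      by (simp add: J_def real_nat_ceiling_ge)
    then have "m \<le> k powr real J"
      using m k by (simp add: log_le_iff)
    then have "m \<le> k ^ J"
      using k by (simp add: powr_realpow)
    then show ?thesis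
      using k d_pos by (simp add: m_def field_simps)
  qed
  have "{v \<in> V. M / k ^ j < X v \<and> X v \<le> M} \<subseteq> (\<Union>i<j. P i)" for j
  proof (induction j)
    case (Suc j)
    have "k * (M / k ^ Suc j) = M / k ^ j"
      using k by simp
    then have "P j = {v \<in> V. M / k ^ Suc j < X v \<and> X v \<le> M / k ^ j}"
      by (simp only: P_def)
    then show ?case
      using Suc by (force simp: lessThan_Suc not_less)
  qed auto
  from this[of J] have "{v \<in> V. X v \<le> M} \<subseteq> {v \<in> V. X v \<le> d} \<union> (\<Union>j<J. P j)"
    using \<open>M / k ^ J \<le> d\<close> by (force simp: not_le)
  moreover have "finite (P j)" for j
    using finite by (simp add: P_def)
  ultimately have "card {v \<in> V. X v \<le> M} \<le> card ({v \<in> V. X v \<le> d} \<union> (\<Union>j<J. P j))"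
    using finite by (intro card_mono) auto
  also have "\<dots> \<le> card {v \<in> V. X v \<le> d} + card (\<Union>j<J. P j)"
    by (rule card_Un_le)
  also have "\<dots> \<le> 1 + (\<Sum>j<J. card (P j))"
    by (intro add_mono card_X_le_d card_UN_le) simp
  finally have "real (card {v \<in> V. X v \<le> M}) \<le> 1 + (\<Sum>j<J. real (card (P j)))"
    by (simp flip: of_nat_sum)
  also have "\<dots> \<le> 1 + real J * (5 * Q)"
    using sum_bounded_above[of "{..<J}" "\<lambda>j. real (card (P j))" "5 * Q"] P by simp
  also have "\<dots> \<le> 1 + (log k m + 1) * (5 * Q)"
  proof -
    have "0 \<le> log k m"
      using m k by simp
    then have "real J \<le> log k m + 1"
      unfolding J_def by linarith
    then show ?thesis
      using Q by (intro add_left_mono mult_right_mono) auto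
  qed
  finally show ?thesis
    by (simp only: M_def m_def Q_def)
qed

lemma card_le:
  assumes k: "2 \<le> k"
  shows "real (card V) \<le> 10 * ((k - 1)\<^sup>2 / k * (max n 2 / d)) powr (1 / 3) *
    (log k (max n 2 / d) + 2)"
proof -
  interpret swap: hyperbola_chain V Y X n d
    by (rule swap)
  define M where "M = max n 2"
  define m where "m = M / d"
  define Q where "Q = ((k - 1)\<^sup>2 / k * m) powr (1 / 3)"
  have M: "2 \<le> M" "n \<le> M"
    by (simp_all add: M_def)
  have m: "2 \<le> m"
    using M d_pos d_le_1 mult_left_mono[of d 1 2] by (simp add: m_def pos_le_divide_eq)
  have Q: "1 \<le> Q"
    using one_le_weight_mult[OF k m] by (simp add: Q_def ge_one_powr_ge_zero)
  \<comment> \<open>The 2 in \<open>max n 2\<close> ensures \<open>M - 1 \<ge> 1\<close>, so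
    \<open>(M - 1) * Y v < n\<close> gives \<open>Y v < n \<le> M\<close>.\<close>
  have "Y v \<le> M" if "v \<in> V" "\<not> X v \<le> M" for v
  proof -
    have "M < n / Y v + 1"
      using X_upper[OF that(1)] that(2) by linarith
    then have "(M - 1) * Y v < n"
      using Y_pos[OF that(1)] by (simp add: field_simps)
    moreover have "Y v \<le> (M - 1) * Y v"
      using M Y_pos[OF that(1)] mult_right_mono[of 1 "M - 1" "Y v"] by simp
    ultimately show ?thesis
      using M by linarith
  qed
  then have "V = {v \<in> V. X v \<le> M} \<union> {v \<in> V. Y v \<le> M}"
    by blast
  then have "card V \<le> card {v \<in> V. X v \<le> M} + card {v \<in> V. Y v \<le> M}"
    using card_Un_le by metis
  then have "real (card V) \<le> real (card {v \<in> V. X v \<le> M}) + real (card {v \<in> V. Y v \<le> M})"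
    by (simp flip: of_nat_add)
  then have "real (card V) \<le> 2 * (1 + (log k m + 1) * (5 * Q))"
    using card_X_le_max[OF k] swap.card_X_le_max[OF k]
    unfolding M_def[symmetric] m_def[symmetric] Q_def[symmetric] by simp
  \<comment> \<open>The two vertices outside the slabs are paid for by
    \<open>2 \<le> 10 * Q\<close>, which raises the 1 next to the logarithm to 2.\<close>
  also have "\<dots> \<le> 10 * Q * (log k m + 2)"
    using Q by (simp add: algebra_simps)
  finally show ?thesis
    by (simp only: M_def m_def Q_def)
qed

end

section \<open>Lattice vectors and determinants\<close>

lemma lattice_closed:
  assumes "plane_lattice L" "x \<in> L" "y \<in> L"
  shows "x + y \<in> L" "x - y \<in> L"
proof -
  obtain u v where L: "L = {of_int a *\<^sub>R u + of_int b *\<^sub>R v | a b. True}"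
    using assms(1) by (auto simp: plane_lattice_def lattice_basis_def)
  obtain a b c d :: int where "x = of_int a *\<^sub>R u + of_int b *\<^sub>R v"
      "y = of_int c *\<^sub>R u + of_int d *\<^sub>R v"
    using assms(2,3) L by blast
  then have "x + y = of_int (a + c) *\<^sub>R u + of_int (b + d) *\<^sub>R v"
      "x - y = of_int (a - c) *\<^sub>R u + of_int (b - d) *\<^sub>R v"
    by (simp_all add: algebra_simps)
  then show "x + y \<in> L" "x - y \<in> L"
    unfolding L by blast+
qed

text \<open>Coordinates in a basis are integers, so the determinant of two lattice vectors is an
  integer multiple of the basis determinant, whose sign goes into \<open>j\<close>.\<close>

lemma lattice_det_multiple:
  assumes "plane_lattice L" "x \<in> L" "y \<in> L"
  obtains j :: int where "x $ 1 * y $ 2 - x $ 2 * y $ 1 = of_int j * lattice_det L"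
proof -
  obtain u v where B: "lattice_basis u v L"
    using assms(1) by (auto simp: plane_lattice_def)
  then have L: "L = {of_int a *\<^sub>R u + of_int b *\<^sub>R v | a b. True}"
    by (simp add: lattice_basis_def)
  obtain a b c d :: int where xy: "x = of_int a *\<^sub>R u + of_int b *\<^sub>R v"
      "y = of_int c *\<^sub>R u + of_int d *\<^sub>R v"
    using assms(2,3) L by blast
  define D where "D = u $ 1 * v $ 2 - u $ 2 * v $ 1"
  have det: "lattice_det L = \<bar>D\<bar>"
    using lattice_det_eq[OF B] by (simp add: measure_parallelogram D_def)
  have eq: "x $ 1 * y $ 2 - x $ 2 * y $ 1 = of_int (a * d - b * c) * D"
    by (simp add: xy D_def algebra_simps)
  show ?thesis
  proof (cases "0 \<le> D")
    case True
    then show ?thesis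
      using that[of "a * d - b * c"] eq det by simp
  next
    case False
    then show ?thesis
      using that[of "- (a * d - b * c)"] eq det by (simp add: algebra_simps)
  qed
qed

text \<open>A positive integer multiple of \<open>lattice_det L\<close> is at least
  \<open>lattice_det L\<close>. Both the coordinate gaps and the area bounds of the chain come from
  here.\<close>

lemma lattice_det_le:
  assumes "plane_lattice L" "x \<in> L" "y \<in> L" "0 < x $ 1 * y $ 2 - x $ 2 * y $ 1"
  shows "0 < lattice_det L" "lattice_det L \<le> x $ 1 * y $ 2 - x $ 2 * y $ 1"
proof -
  obtain j :: int where j: "x $ 1 * y $ 2 - x $ 2 * y $ 1 = of_int j * lattice_det L"
    using lattice_det_multiple[OF assms(1-3)] .
  obtain u v where "lattice_basis u v L"
    using assms(1) by (auto simp: plane_lattice_def)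
  then have ge: "0 \<le> lattice_det L"
    by (simp add: lattice_det_eq)
  then show pos: "0 < lattice_det L"
    using assms(4) j by (cases "lattice_det L = 0") auto
  have "0 < real_of_int j"
    using assms(4) pos unfolding j by (simp add: zero_less_mult_iff)
  then have "1 \<le> real_of_int j"
    by simp
  then show "lattice_det L \<le> x $ 1 * y $ 2 - x $ 2 * y $ 1"
    unfolding j using mult_right_mono[of 1 "real_of_int j" "lattice_det L"] ge by simp
qed

section \<open>Hull vertices as a hyperbola chain\<close>

lemma extreme_point_not_midpoint:
  fixes v w :: "'a::real_vector"
  assumes "v extreme_point_of C" "w \<noteq> 0" "v - w \<in> C"
  shows "v + w \<notin> C"
proof
  assume "v + w \<in> C"
  have "v = (1 - 1 / 2) *\<^sub>R (v - w) + (1 / 2) *\<^sub>R (v + w)"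
    by (simp add: algebra_simps flip: scaleR_add_left)
  moreover have "v - w \<noteq> v + w"
  proof
    assume "v - w = v + w"
    then have "2 *\<^sub>R w = 0"
      by (simp add: scaleR_2 algebra_simps)
    then show False
      using assms(2) by simp
  qed
  ultimately have "v \<in> open_segment (v - w) (v + w)"
    unfolding in_segment by (intro conjI exI[of _ "1 / 2"]) simp_all
  then show False
    using assms \<open>v + w \<in> C\<close> by (simp add: extreme_point_of_def)
qed

text \<open>The point set \<open>S\<close> absorbs lattice vectors of the closed first quadrant,
  while subtracting such a nonzero vector from a vertex leaves \<open>S\<close>. Finite subsets are
  considered because finiteness of the vertex set is itself deduced from the bound.\<close>

lemma hyperbola_chain_hull_vertices:
  assumes "finite V" "V \<subseteq> hull_vertices n p L" "0 < n" "plane_lattice L" "integer_lattice \<subseteq> L"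
  shows "hyperbola_chain V (\<lambda>v. v $ 1) (\<lambda>v. v $ 2) n (lattice_det L)"
proof -
  define S where "S = hyperbola_region n \<inter> (\<lambda>v. p + v) ` L"
  have mem_S: "v \<in> S \<longleftrightarrow> 0 \<le> v $ 1 \<and> 0 \<le> v $ 2 \<and> n \<le> v $ 1 * v $ 2 \<and> v - p \<in> L" for v
    unfolding S_def hyperbola_region_def by (force simp: image_iff)
  have ext: "v extreme_point_of (convex hull S)" if "v \<in> V" for v
    using assms(2) that by (auto simp: hull_vertices_def S_def)
  have V_S: "v \<in> S" if "v \<in> V" for v
    using ext[OF that] by (rule extreme_point_of_convex_hull)
  have S_hull: "v \<in> convex hull S" if "v \<in> S" for v
    using that by (rule hull_inc)
  have diff: "v - u \<in> L" if "u \<in> S" "v \<in> S" for u v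
    using lattice_closed(2)[OF assms(4), of "v - p" "u - p"] that by (simp add: mem_S)
  have int: "vector [real_of_int a, real_of_int b] \<in> L" for a b
    using assms(5) by (auto simp: integer_lattice_def forall_2)
  have e1: "vector [1, 0] \<in> L" and e2: "vector [0, 1] \<in> L"
    using int[of 1 0] int[of 0 1] by simp_all
  have up: "v + w \<in> S" if "v \<in> S" "w \<in> L" "0 \<le> w $ 1" "0 \<le> w $ 2" for v w
  proof -
    have "v $ 1 * v $ 2 \<le> (v + w) $ 1 * (v + w) $ 2"
      using that by (intro mult_mono) (auto simp: mem_S)
    moreover have "v + w - p \<in> L"
      using lattice_closed(1)[OF assms(4), of "v - p" w] that by (simp add: mem_S algebra_simps)
    ultimately show ?thesis
      using that by (simp add: mem_S)
  qed
  \<comment> \<open>Otherwise \<open>v\<close> would be the midpoint of \<open>v - w\<close> and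
    \<open>v + w\<close>, both in \<open>S\<close>.\<close>
  have minimal: "v - w \<notin> S" if "v \<in> V" "w \<in> L" "0 \<le> w $ 1" "0 \<le> w $ 2" "w \<noteq> 0" for v w
    using extreme_point_not_midpoint[OF ext[OF that(1)] that(5)] up[OF V_S that(2-4)] that(1)
      S_hull by blast
  have pos: "0 < v $ 1" "0 < v $ 2" if "v \<in> V" for v
  proof -
    have "0 < v $ 1 * v $ 2"
      using V_S[OF that] assms(3) by (simp add: mem_S)
    then show "0 < v $ 1" "0 < v $ 2"
      using V_S[OF that] by (auto simp: mem_S zero_less_mult_iff)
  qed
  \<comment> \<open>The determinant of \<open>v - u\<close> and the unit vector (0,1) is the
    difference of the first coordinates.\<close>
  have gap: "lattice_det L \<le> v $ 1 - u $ 1" if "u \<in> V" "v \<in> V" "u $ 1 < v $ 1" for u v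
    using lattice_det_le(2)[OF assms(4) diff[OF V_S V_S] e2, of u v] that by simp
  have gap': "lattice_det L \<le> v $ 2 - u $ 2" if "u \<in> V" "v \<in> V" "u $ 2 < v $ 2" for u v
    using lattice_det_le(2)[OF assms(4) e1 diff[OF V_S V_S], of u v] that by simp
  show ?thesis
  proof
    show "0 < lattice_det L" "lattice_det L \<le> 1"
      using lattice_det_le[OF assms(4) e1 e2] by simp_all
  next
    fix v assume v: "v \<in> V"
    note p = pos[OF v]
    \<comment> \<open>Otherwise \<open>v\<close> shifted down by 1 would still lie in
      \<open>S\<close>, against \<open>minimal\<close>; the other direction is analogous with
      (1,0).\<close>
    show "v $ 2 < n / v $ 1 + 1"
    proof (rule ccontr)
      assume "\<not> v $ 2 < n / v $ 1 + 1"
      then have le: "n / v $ 1 \<le> v $ 2 - 1"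
        by simp
      have "0 \<le> n / v $ 1"
        using p assms(3) by simp
      then have "1 \<le> v $ 2"
        using le by linarith
      moreover have "n \<le> v $ 1 * (v $ 2 - 1)"
        using le p by (simp add: pos_divide_le_eq mult.commute)
      moreover have "v - vector [0, 1] - p \<in> L"
        using lattice_closed(2)[OF assms(4) _ e2, of "v - p"] V_S[OF v]
        by (simp add: mem_S algebra_simps)
      ultimately have "v - vector [0, 1] \<in> S"
        using p by (simp add: mem_S)
      then show False
        using minimal[OF v e2] by (simp add: vec_eq_iff forall_2)
    qed
    show "v $ 1 < n / v $ 2 + 1"
    proof (rule ccontr)
      assume "\<not> v $ 1 < n / v $ 2 + 1"
      then have le: "n / v $ 2 \<le> v $ 1 - 1"
        by simp
      have "0 \<le> n / v $ 2"
        using p assms(3) by simp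
      then have "1 \<le> v $ 1"
        using le by linarith
      moreover have "n \<le> (v $ 1 - 1) * v $ 2"
        using le p by (simp add: pos_divide_le_eq)
      moreover have "v - vector [1, 0] - p \<in> L"
        using lattice_closed(2)[OF assms(4) _ e1, of "v - p"] V_S[OF v]
        by (simp add: mem_S algebra_simps)
      ultimately have "v - vector [1, 0] \<in> S"
        using p by (simp add: mem_S)
      then show False
        using minimal[OF v e1] by (simp add: vec_eq_iff forall_2)
    qed
  next
    fix u v assume *: "u \<in> V" "v \<in> V" "u \<noteq> v" "u $ 1 \<le> v $ 1"
    then have "v - (v - u) \<in> S"
      using V_S[of u] by simp
    then have "\<not> 0 \<le> (v - u) $ 2"
      using minimal[OF *(2) diff[OF V_S V_S], of u v] * by auto
    then show "v $ 2 < u $ 2"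
      by simp
  next
    fix u v w assume *: "u \<in> V" "v \<in> V" "w \<in> V" "u $ 1 < v $ 1" "v $ 1 < w $ 1"
    define D where "D = (u $ 2 - v $ 2) * (w $ 1 - v $ 1) - (v $ 2 - w $ 2) * (v $ 1 - u $ 1)"
    have D: "(v - u) $ 1 * (w - v) $ 2 - (v - u) $ 2 * (w - v) $ 1 = D"
      by (simp add: D_def algebra_simps)
    \<comment> \<open>Strict convexity at \<open>v\<close>: otherwise \<open>v\<close> lies on or
      above the segment from \<open>u\<close> to \<open>w\<close>, hence inside an open segment with
      endpoints in the hull.\<close>
    have "0 < D"
    proof (rule ccontr)
      assume "\<not> 0 < D"
      \<comment> \<open>Here \<open>q\<close> is the point of that segment on the vertical line
        through \<open>v\<close>, and \<open>c\<close> is the height of \<open>v\<close> over it,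
        with \<open>c * (w $ 1 - u $ 1) = - D\<close>.\<close>
      define t where "t = (v $ 1 - u $ 1) / (w $ 1 - u $ 1)"
      define q where "q = (1 - t) *\<^sub>R u + t *\<^sub>R w"
      define c where "c = v $ 2 - q $ 2"
      \<comment> \<open>An integer height makes \<open>e\<close> a lattice vector, so
        \<open>q + e\<close> stays in the hull; \<open>c < N\<close> puts \<open>v\<close> strictly
        below it.\<close>
      obtain N :: nat where N: "c < real N"
        using reals_Archimedean2 by blast
      define e :: "real^2" where "e = vector [0, real N]"
      have t: "0 < t" "t < 1"
        using * by (simp_all add: t_def)
      have tw: "t * (w $ 1 - u $ 1) = v $ 1 - u $ 1"
        using * by (simp add: t_def)
      then have q1: "q $ 1 = v $ 1"
        by (simp add: q_def algebra_simps)
      have "c * (w $ 1 - u $ 1) =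
          (v $ 2 - u $ 2) * (w $ 1 - u $ 1) - t * (w $ 1 - u $ 1) * (w $ 2 - u $ 2)"
        by (simp add: c_def q_def algebra_simps)
      also have "\<dots> = - D"
        unfolding tw by (simp add: D_def algebra_simps)
      finally have "0 \<le> c * (w $ 1 - u $ 1)"
        using \<open>\<not> 0 < D\<close> by simp
      then have c: "0 \<le> c"
        using * by (simp add: zero_le_mult_iff)
      have e: "e \<in> L" "0 \<le> e $ 1" "0 \<le> e $ 2"
        using int[of 0 "int N"] by (simp_all add: e_def)
      have q: "q \<in> convex hull S"
        unfolding q_def using t V_S * by (intro convexD_alt convex_convex_hull S_hull) auto
      have "q + e = (1 - t) *\<^sub>R (u + e) + t *\<^sub>R (w + e)"
        by (simp add: q_def algebra_simps)
      also have "\<dots> \<in> convex hull S"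
        using t V_S * e up by (intro convexD_alt convex_convex_hull S_hull) auto
      finally have qe: "q + e \<in> convex hull S" .
      show False
      proof (cases "c = 0")
        \<comment> \<open>Now \<open>v\<close> is an endpoint of the vertical segment, so the
          segment from \<open>u\<close> to \<open>w\<close> is used instead.\<close>
        case True
        then have "v = q"
          using q1 by (simp add: vec_eq_iff forall_2 c_def)
        then have "v \<in> open_segment u w"
          using t * unfolding in_segment q_def by (intro conjI exI[of _ t]) auto
        then show False
          using ext[OF *(2)] S_hull V_S * unfolding extreme_point_of_def by blast
      next
        case False
        then have N0: "0 < real N"
          using c N by linarith
        have "v = q + (c / N) *\<^sub>R e"
          using q1 N0 by (simp add: vec_eq_iff forall_2 e_def) (simp add: c_def)
        then have "v = (1 - c / N) *\<^sub>R q + (c / N) *\<^sub>R (q + e)"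
          by (simp add: scaleR_left_diff_distrib scaleR_right_distrib)
        moreover have "q \<noteq> q + e"
          using N0 by (simp add: vec_eq_iff forall_2 e_def)
        ultimately have "v \<in> open_segment q (q + e)"
          using c False N N0 unfolding in_segment by (intro conjI exI[of _ "c / N"]) auto
        then show False
          using ext[OF *(2)] q qe unfolding extreme_point_of_def by blast
      qed
    qed
    then have "lattice_det L \<le> D"
      using lattice_det_le(2)[OF assms(4) diff[OF V_S V_S] diff[OF V_S V_S], of u v v w] * D by simp
    then show "lattice_det L \<le> (u $ 2 - v $ 2) * (w $ 1 - v $ 1) - (v $ 2 - w $ 2) * (v $ 1 - u $ 1)"
      by (simp only: D_def)
  qed (use assms(1,3) pos V_S gap gap' mem_S in simp_all)
qed

section \<open>The explicit and the asymptotic bound\<close>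

text \<open>The unit vectors force \<open>lattice_det L \<le> 1\<close>. The bound keeps the
  logarithms of the size parameter away from 0.\<close>

lemma size_parameter_ge_2:
  assumes "plane_lattice L" "integer_lattice \<subseteq> L"
  shows "2 \<le> size_parameter n L"
proof -
  have "vector [1, 0] \<in> L" "vector [0, 1] \<in> L"
    using assms(2) by (auto simp: integer_lattice_def forall_2)
  from lattice_det_le[OF assms(1) this]
  have "0 < lattice_det L" "lattice_det L \<le> 1"
    by simp_all
  then have "1 * 2 \<le> (1 / lattice_det L) * max n 2"
    by (intro mult_mono) auto
  then show ?thesis
    by (simp add: size_parameter_def)
qed

lemma card_hull_vertices_le:
  assumes "0 < n" "plane_lattice L" "integer_lattice \<subseteq> L" "2 \<le> k"
  defines "m \<equiv> size_parameter n L"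
  shows "finite (hull_vertices n p L)"
    and "real (card (hull_vertices n p L)) \<le>
      (2 ^ 8 * pi\<^sup>2 * (k - 1)\<^sup>2 / k) powr (1 / 3) * m powr (1 / 3) * (log k m + 2)"
proof -
  define C where "C = 10 * ((k - 1)\<^sup>2 / k * m) powr (1 / 3) * (log k m + 2)"
  have m: "2 \<le> m"
    using size_parameter_ge_2[OF assms(2,3)] by (simp add: m_def)
  have log: "0 \<le> log k m"
    using m assms(4) by simp
  \<comment> \<open>A bound uniform over all finite subsets yields both finiteness and the estimate
    for the whole vertex set.\<close>
  have bound: "card V \<le> nat \<lfloor>C\<rfloor>" if "finite V" "V \<subseteq> hull_vertices n p L" for V
  proof -
    interpret hyperbola_chain V "\<lambda>v. v $ 1" "\<lambda>v. v $ 2" n "lattice_det L"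
      using hyperbola_chain_hull_vertices[OF that assms(1-3)] .
    have "max n 2 / lattice_det L = m"
      by (simp add: m_def size_parameter_def)
    then have "real (card V) \<le> C"
      using card_le[OF assms(4)] by (simp add: C_def)
    then show ?thesis
      by linarith
  qed
  then have fin: "finite (hull_vertices n p L) \<and> card (hull_vertices n p L) \<le> nat \<lfloor>C\<rfloor>"
    by (intro finite_if_finite_subsets_card_bdd)
  then show "finite (hull_vertices n p L)"
    by simp
  have "0 \<le> C"
    using log by (simp add: C_def)
  then have "real (card (hull_vertices n p L)) \<le> C"
    using fin by linarith
  also have "C = (10 * ((k - 1)\<^sup>2 / k) powr (1 / 3)) * m powr (1 / 3) * (log k m + 2)"
    by (simp only: C_def powr_mult mult.assoc)
  also have "10 * ((k - 1)\<^sup>2 / k) powr (1 / 3) = (10 ^ 3 * ((k - 1)\<^sup>2 / k)) powr (1 / 3)"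
    using powr_powr[of "10::real" 3 "1 / 3"] by (simp only: powr_mult) simp
  also have "(10 ^ 3 * ((k - 1)\<^sup>2 / k)) powr (1 / 3) * m powr (1 / 3) * (log k m + 2) \<le>
      (2 ^ 8 * pi\<^sup>2 * (k - 1)\<^sup>2 / k) powr (1 / 3) * m powr (1 / 3) * (log k m + 2)"
  proof (intro mult_right_mono powr_mono2)
    \<comment> \<open>The constants compare as
      \<open>10 ^ 3 \<le> 2 ^ 8 * 3\<^sup>2 \<le> 2 ^ 8 * pi\<^sup>2\<close>.\<close>
    have "3\<^sup>2 \<le> pi\<^sup>2"
      using pi_gt3 by (intro power_mono) auto
    then have "10 ^ 3 * ((k - 1)\<^sup>2 / k) \<le> (2 ^ 8 * pi\<^sup>2) * ((k - 1)\<^sup>2 / k)"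
      using assms(4) by (intro mult_right_mono) auto
    then show "10 ^ 3 * ((k - 1)\<^sup>2 / k) \<le> 2 ^ 8 * pi\<^sup>2 * (k - 1)\<^sup>2 / k"
      by simp
  qed (use log assms(4) in auto)
  finally show "real (card (hull_vertices n p L)) \<le>
      (2 ^ 8 * pi\<^sup>2 * (k - 1)\<^sup>2 / k) powr (1 / 3) * m powr (1 / 3) * (log k m + 2)" .
qed

theorem theorem2p2:
  shows "(\<forall>(n::real) (p::real^2) (L::(real^2) set).
            n > 0 \<and> admissible_superlattice L \<longrightarrow>
            (\<forall>k::real. k \<ge> 2 \<longrightarrow>
               finite (hull_vertices n p L) \<and>
               real (card (hull_vertices n p L)) \<le>
                 (2 ^ 8 * pi\<^sup>2 * (k - 1)\<^sup>2 / k) powr (1 / 3) *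
                 size_parameter n L powr (1 / 3) * (log k (size_parameter n L) + 2)))
       \<and> (\<exists>C>0. \<forall>(n::real) (p::real^2) (L::(real^2) set).
            n > 0 \<and> admissible_superlattice L \<longrightarrow>
            real (card (hull_vertices n p L)) \<le>
              C * (size_parameter n L powr (1 / 3) * ln (size_parameter n L)))"
proof (intro conjI)
  show "\<forall>(n::real) (p::real^2) (L::(real^2) set).
            n > 0 \<and> admissible_superlattice L \<longrightarrow>
            (\<forall>k::real. k \<ge> 2 \<longrightarrow>
               finite (hull_vertices n p L) \<and>
               real (card (hull_vertices n p L)) \<le>
                 (2 ^ 8 * pi\<^sup>2 * (k - 1)\<^sup>2 / k) powr (1 / 3) *
                 size_parameter n L powr (1 / 3) * (log k (size_parameter n L) + 2))"
    using card_hull_vertices_le by (auto simp: admissible_superlattice_def)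
next
  \<comment> \<open>The first factor of the explicit bound at \<open>k = 2\<close>.\<close>
  define c :: real where "c = (2 ^ 8 * pi\<^sup>2 * (2 - 1)\<^sup>2 / 2) powr (1 / 3)"
  have c: "0 < c"
    by (simp add: c_def)
  have "real (card (hull_vertices n p L)) \<le>
      (c * (3 / ln 2)) * (size_parameter n L powr (1 / 3) * ln (size_parameter n L))"
    if "0 < n" "admissible_superlattice L" for n p L
  proof -
    define m where "m = size_parameter n L"
    have L: "plane_lattice L" "integer_lattice \<subseteq> L"
      using that(2) by (simp_all add: admissible_superlattice_def)
    have m: "2 \<le> m"
      using size_parameter_ge_2[OF L] by (simp add: m_def)
    have "real (card (hull_vertices n p L)) \<le> c * m powr (1 / 3) * (log 2 m + 2)"
      using card_hull_vertices_le(2)[OF that(1) L, of 2 p] by (simp add: c_def m_def)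
    \<comment> \<open>From \<open>m \<ge> 2\<close> follows \<open>log 2 m \<ge> 1\<close>, so the
      summand 2 is at most \<open>2 * log 2 m\<close>.\<close>
    also have "\<dots> \<le> c * m powr (1 / 3) * (3 * log 2 m)"
      using m c by (intro mult_left_mono) (simp_all add: le_log_iff)
    also have "\<dots> = (c * (3 / ln 2)) * (m powr (1 / 3) * ln m)"
      by (simp add: log_def)
    finally show ?thesis
      by (simp only: m_def)
  qed
  moreover have "0 < c * (3 / ln 2)"
    using c by simp
  ultimately show "\<exists>C>0. \<forall>(n::real) (p::real^2) (L::(real^2) set).
            n > 0 \<and> admissible_superlattice L \<longrightarrow>
            real (card (hull_vertices n p L)) \<le>
              C * (size_parameter n L powr (1 / 3) * ln (size_parameter n L))"
    by blast
qed

end
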